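(* Let $\mu>0$, $\lambda>0$, $\sigma>0$ satisfy $\frac{\mu\lambda}{\sigma^2}\le 1$ and let $x_0\in\mathbb{R}$. Then $$\mathcal{T}_{\mu\lambda}^{(\sigma)}(x_0)=\begin{cases}\{0\}, & |x_0|\le \frac{\mu\lambda}{\sigma},\\[2pt] \left\{\sigma W_0\!\left(-\frac{\mu\lambda}{\sigma^2}e^{-\frac{|x_0|}{\sigma}}\right)+|x_0|\right\}, & \text{otherwise.}\end{cases}$$
   Context: For $\mu,\lambda,\sigma>0$ and $x_0\in\mathbb{R}$, let $\widehat{L}(x,x_0):=\lambda\left(1-e^{-\frac{x}{\sigma}}\right)+\frac{1}{2\mu}(x-|x_0|)^2$ for $x\ge 0$, and let $\mathcal{T}_{\mu\lambda}^{(\sigma)}(x_0):=\arg\min_{x\ge 0}\widehat{L}(x,x_0)$ denote the set of all global minimizers of $\widehat{L}(\cdot,x_0)$ over $[0,+\infty)$. (The proximal operator of the piece-wise exponential function $1-e^{-|x|/\sigma}$ is then $\mathrm{sign}(x_0)\mathcal{T}_{\mu\lambda}^{(\sigma)}(x_0)$.) $W_0$ is the principal branch of the Lambert W function: for $y\in[-\frac1e,+\infty)$, $W_0(y)$ is the unique $w\ge -1$ with $we^{w}=y$. *)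

theory Defs
  imports Complex_Main
begin

definition prox_objective :: "real \<Rightarrow> real \<Rightarrow> real \<Rightarrow> real \<Rightarrow> real \<Rightarrow> real" where
  "prox_objective \<mu> lam \<sigma> x x\<^sub>0 = lam * (1 - exp (- x / \<sigma>)) + 1 / (2 * \<mu>) * (x - \<bar>x\<^sub>0\<bar>)\<^sup>2"

definition prox_argmin :: "real \<Rightarrow> real \<Rightarrow> real \<Rightarrow> real \<Rightarrow> real set" where
  "prox_argmin \<mu> lam \<sigma> x\<^sub>0 = {x. is_arg_min (\<lambda>x. prox_objective \<mu> lam \<sigma> x x\<^sub>0) (\<lambda>x. x \<ge> 0) x}"

(* Only meaningful for y \<ge> - 1 / e; see Lambert_W0_ex1. *)
definition Lambert_W0 :: "real \<Rightarrow> real" where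
  "Lambert_W0 y = (THE w. w \<ge> -1 \<and> w * exp w = y)"

lemma mult_exp_strict_mono:
  fixes a b :: real
  assumes "-1 \<le> a" "a < b"
  shows "a * exp a < b * exp b"
proof (rule DERIV_pos_imp_increasing_open[OF \<open>a < b\<close>])
  fix x assume "a < x" "x < b"
  then have "((\<lambda>x. x * exp x) has_real_derivative (1 + x) * exp x) (at x)"
    by (auto intro!: derivative_eq_intros simp: algebra_simps)
  moreover have "(1 + x) * exp x > 0"
    using \<open>a < x\<close> assms by simp
  ultimately show "\<exists>d. ((\<lambda>x. x * exp x) has_real_derivative d) (at x) \<and> d > 0"
    by blast
qed (intro continuous_intros)

lemma Lambert_W0_ex1:
  fixes y :: real
  assumes "y \<ge> - (1 / exp 1)"
  shows "\<exists>!w. w \<ge> -1 \<and> w * exp w = y"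
proof (rule ex_ex1I)
  have "\<bar>y\<bar> * 1 \<le> \<bar>y\<bar> * exp \<bar>y\<bar>"
    by (intro mult_left_mono) auto
  then have "y \<le> \<bar>y\<bar> * exp \<bar>y\<bar>"
    by linarith
  moreover have "-1 * exp (-1) \<le> y"
    using assms by (simp add: exp_minus field_simps)
  ultimately have "\<exists>w\<ge>-1. w \<le> \<bar>y\<bar> \<and> w * exp w = y"
    by (intro IVT') (auto intro!: continuous_intros)
  then show "\<exists>w. w \<ge> -1 \<and> w * exp w = y"
    by blast
next
  fix v w :: real
  assume "v \<ge> -1 \<and> v * exp v = y" "w \<ge> -1 \<and> w * exp w = y"
  then show "v = w"
    using mult_exp_strict_mono[of v w] mult_exp_strict_mono[of w v]
    by (cases v w rule: linorder_cases) auto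
qed

end

theory Submission
  imports Defs
begin

text \<open>
  The bound \<open>\<mu> * lam / \<sigma>\<^sup>2 \<le> 1\<close> says that on the half-line \<open>x \<ge> 0\<close> the curvature \<open>1 / \<mu>\<close> of the
  quadratic term dominates the negative curvature \<open>- (lam / \<sigma>\<^sup>2) * exp (- x / \<sigma>)\<close> of the concave
  penalty, strictly so for \<open>x > 0\<close>.  Hence the objective has a strictly increasing derivative
  there, also in the borderline case of equality (\<open>prox_slope_strict_mono\<close>), and any first-order
  point is the only minimizer (\<open>prox_argmin_eqI\<close>).

  It remains to find that point.  Its nature is decided by the slope at the boundary point \<open>0\<close>,
  which is \<open>lam / \<sigma> - \<bar>x\<^sub>0\<bar> / \<mu>\<close>: if it is nonnegative, the minimizer is \<open>0\<close>.  Otherwise the slope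
  has to vanish at the minimizer \<open>x\<close>, and the substitution \<open>w = (x - \<bar>x\<^sub>0\<bar>) / \<sigma>\<close> turns this into
  \<open>w * exp w = - (\<mu> * lam / \<sigma>\<^sup>2) * exp (- \<bar>x\<^sub>0\<bar> / \<sigma>)\<close>.  The principal branch provides the solution
  with \<open>x \<ge> 0\<close>, because the map from \<open>w\<close> to \<open>w * exp w\<close> is increasing on \<open>w \<ge> -1\<close>.
\<close>

definition prox_slope :: "real \<Rightarrow> real \<Rightarrow> real \<Rightarrow> real \<Rightarrow> real \<Rightarrow> real" where
  "prox_slope \<mu> lam \<sigma> x x\<^sub>0 = lam / \<sigma> * exp (- x / \<sigma>) + (x - \<bar>x\<^sub>0\<bar>) / \<mu>"

lemma has_derivative_prox_objective:
  assumes "\<mu> > 0" "\<sigma> > 0"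
  shows "((\<lambda>x. prox_objective \<mu> lam \<sigma> x x\<^sub>0) has_real_derivative prox_slope \<mu> lam \<sigma> x x\<^sub>0) (at x)"
  unfolding prox_objective_def prox_slope_def using assms
  by (auto intro!: derivative_eq_intros simp: field_simps)

text \<open>
  Comparing increments instead of second derivatives gives strictness at once: between \<open>u\<close> and \<open>v\<close>
  the exponential term, rescaled, drops by at most \<open>1 - exp (- (v - u) / \<sigma>)\<close>, which is strictly less
  than the gain \<open>(v - u) / \<sigma>\<close> of the linear term.
\<close>
lemma prox_slope_strict_mono:
  assumes "\<mu> > 0" "lam > 0" "\<sigma> > 0" "\<mu> * lam / \<sigma>\<^sup>2 \<le> 1" "0 \<le> u" "u < v"
  shows "prox_slope \<mu> lam \<sigma> u x\<^sub>0 < prox_slope \<mu> lam \<sigma> v x\<^sub>0"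
proof -
  define c where "c = \<mu> * lam / \<sigma>\<^sup>2"
  define t where "t = (v - u) / \<sigma>"
  have t: "t > 0" using assms by (simp add: t_def)
  have split: "exp (- (v / \<sigma>)) = exp (- (u / \<sigma>)) * exp (- t)"
    using assms(3) by (simp add: t_def exp_add[symmetric] field_simps)
  have c: "0 \<le> c" "c \<le> 1" using assms by (auto simp: c_def)
  have "c * exp (- u / \<sigma>) \<le> 1"
    using c assms by (intro mult_le_one) auto
  moreover have "0 \<le> 1 - exp (- t)" using t by simp
  ultimately have "c * exp (- u / \<sigma>) * (1 - exp (- t)) \<le> 1 - exp (- t)"
    by (rule mult_left_le_one_le[rotated 2]) (use c in auto)
  also have "1 - exp (- t) < t"
    using exp_minus_greater[of t] t by simp
  finally have "(\<sigma> / \<mu>) * (c * exp (- u / \<sigma>) * (1 - exp (- t))) < (\<sigma> / \<mu>) * t"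
    using assms by (intro mult_strict_left_mono) auto
  moreover have "(\<sigma> / \<mu>) * t = (v - u) / \<mu>"
    using assms by (simp add: t_def)
  moreover have "(\<sigma> / \<mu>) * (c * exp (- u / \<sigma>) * (1 - exp (- t)))
      = lam / \<sigma> * (exp (- u / \<sigma>) - exp (- v / \<sigma>))"
    using assms by (simp add: split c_def field_simps power2_eq_square)
  ultimately show ?thesis
    by (simp add: prox_slope_def algebra_simps diff_divide_distrib)
qed

text \<open>
  The first-order condition for minimizing a convex function over \<open>x \<ge> 0\<close>: a positive slope is
  allowed only at the boundary point.
\<close>
lemma prox_argmin_eqI:
  assumes "\<mu> > 0" "lam > 0" "\<sigma> > 0" "\<mu> * lam / \<sigma>\<^sup>2 \<le> 1"
    and "p \<ge> 0" "prox_slope \<mu> lam \<sigma> p x\<^sub>0 \<ge> 0" "p = 0 \<or> prox_slope \<mu> lam \<sigma> p x\<^sub>0 = 0"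
  shows "prox_argmin \<mu> lam \<sigma> x\<^sub>0 = {p}"
proof -
  let ?f = "\<lambda>x. prox_objective \<mu> lam \<sigma> x x\<^sub>0" and ?s = "\<lambda>x. prox_slope \<mu> lam \<sigma> x x\<^sub>0"
  note deriv = has_derivative_prox_objective[OF assms(1,3), of lam x\<^sub>0]
  note mono = prox_slope_strict_mono[OF assms(1-4), where x\<^sub>0 = x\<^sub>0]
  have less: "?f p < ?f x" if "x \<ge> 0" "x \<noteq> p" for x
  proof (cases "p < x")
    case True
    then obtain z where z: "p < z" "?f x - ?f p = (x - p) * ?s z"
      using MVT2[OF True, of ?f ?s] deriv by blast
    have "?s z > 0" using mono[of p z] z assms by linarith
    then have "?f x - ?f p > 0" using z True by simp
    then show ?thesis by simp
  next
    case False
    then have "x < p" using that by simp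
    then obtain z where z: "x < z" "z < p" "?f p - ?f x = (p - x) * ?s z"
      using MVT2[of x p ?f ?s] deriv by blast
    have "?s z < 0" using mono[of z p] z assms \<open>x \<ge> 0\<close> by auto
    then have "?f p - ?f x < 0" using z \<open>x < p\<close> by (simp add: mult_pos_neg)
    then show ?thesis by simp
  qed
  then show ?thesis
    using \<open>p \<ge> 0\<close> by (fastforce simp: prox_argmin_def is_arg_min_def)
qed

text \<open>
  The argument \<open>- c * exp (- a)\<close> with \<open>c < a\<close> lies above both \<open>- c * exp (- c)\<close>, hence in the domain
  of the principal branch, and \<open>- a * exp (- a)\<close>, which yields the lower bound \<open>- a\<close>.
\<close>
lemma Lambert_W0_above:
  assumes "0 < c" "c \<le> 1" "c < a"
  defines "w \<equiv> Lambert_W0 (- c * exp (- a))"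
  shows "w * exp w = - c * exp (- a)" and "- a \<le> w"
proof -
  have "(- 1) * exp (- 1) \<le> (- c) * exp (- c)"
    using mult_exp_strict_mono[of "- 1" "- c"] assms by (cases "c = 1") auto
  also have "\<dots> \<le> - c * exp (- a)" using assms by simp
  finally have "- c * exp (- a) \<ge> - (1 / exp 1)" by (simp add: exp_minus field_simps)
  from theI'[OF Lambert_W0_ex1[OF this]]
  have w: "w \<ge> - 1" "w * exp w = - c * exp (- a)"
    by (simp_all add: w_def Lambert_W0_def)
  show "w * exp w = - c * exp (- a)" by (fact w)
  show "- a \<le> w"
  proof (rule ccontr)
    assume "\<not> - a \<le> w"
    then have "w * exp w < (- a) * exp (- a)"
      using mult_exp_strict_mono[of w "- a"] w by simp
    also have "\<dots> < - c * exp (- a)" using assms by simp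
    finally show False using w by simp
  qed
qed

theorem mainTheorem1:
  fixes \<mu> lam \<sigma> x\<^sub>0 :: real
  assumes "\<mu> > 0" and "lam > 0" and "\<sigma> > 0"
    and "\<mu> * lam / \<sigma>\<^sup>2 \<le> 1"
  shows "prox_argmin \<mu> lam \<sigma> x\<^sub>0 =
    (if \<bar>x\<^sub>0\<bar> \<le> \<mu> * lam / \<sigma> then {0}
     else {\<sigma> * Lambert_W0 (- (\<mu> * lam / \<sigma>\<^sup>2) * exp (- \<bar>x\<^sub>0\<bar> / \<sigma>)) + \<bar>x\<^sub>0\<bar>})"
proof (cases "\<bar>x\<^sub>0\<bar> \<le> \<mu> * lam / \<sigma>")
  case True
  then have "prox_slope \<mu> lam \<sigma> 0 x\<^sub>0 \<ge> 0"
    using assms by (simp add: prox_slope_def field_simps)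
  then show ?thesis
    using True prox_argmin_eqI[OF assms, of 0] by simp
next
  case False
  define c where "c = \<mu> * lam / \<sigma>\<^sup>2"
  define a where "a = \<bar>x\<^sub>0\<bar> / \<sigma>"
  define w where "w = Lambert_W0 (- c * exp (- a))"
  define p where "p = \<sigma> * w + \<bar>x\<^sub>0\<bar>"
  have "0 < c" "c \<le> 1" "c < a"
    using False assms by (auto simp: c_def a_def field_simps power2_eq_square)
  note w = Lambert_W0_above[OF this, folded w_def]
  have p: "p = \<sigma> * (w + a)"
    using assms by (simp add: p_def a_def field_simps)
  have "p \<ge> 0"
    using w(2) assms by (simp add: p)
  have "c * exp (- p / \<sigma>) * exp w = c * exp (- a)"
    using assms by (simp add: p exp_add[symmetric])
  also have "\<dots> = - w * exp w" using w(1) by simp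
  finally have "c * exp (- p / \<sigma>) = - w"
    by (metis mult_right_cancel exp_not_eq_zero)
  moreover have "prox_slope \<mu> lam \<sigma> p x\<^sub>0 = (\<sigma> / \<mu>) * (c * exp (- p / \<sigma>) + w)"
    using assms by (simp add: prox_slope_def c_def p_def field_simps power2_eq_square)
  ultimately have "prox_slope \<mu> lam \<sigma> p x\<^sub>0 = 0" by simp
  then have "prox_argmin \<mu> lam \<sigma> x\<^sub>0 = {p}"
    using prox_argmin_eqI[OF assms \<open>p \<ge> 0\<close>] by simp
  then show ?thesis
    using False by (simp add: p_def w_def c_def a_def)
qed

end
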